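(* Let $S$ be a finitely generated inverse semigroup, let $X$ be a locally compact Boolean space, and let $\alpha\colon S\curvearrowright X$ be a Boolean action. Then $\alpha$ has finitely many fixed points. More precisely, the number of fixed points of $\alpha$ is equal to or less than the number of nonzero semigroup homomorphisms from $S$ to $\{0,1\}$.
   Context: An inverse semigroup is a semigroup $S$ in which every $s$ has a unique $s^*$ with $s=ss^*s$, $s^*=s^*ss^*$; $E(S)$ is its set of idempotents. $S$ is finitely generated if it is generated by a finite set under product and $s\mapsto s^*$. $\{0,1\}$ carries the usual product. A locally compact Boolean space is a locally compact Hausdorff space with a basis of compact open sets. For a topological space $X$, $I_X$ is the inverse semigroup of homeomorphisms between open subsets of $X$ (with composition of partial maps). An action $\alpha\colon S\curvearrowright X$ is a semigroup homomorphism $s\mapsto\alpha_s\in I_X$; $D_e^\alpha$ denotes the domain of $\alpha_e$ for $e\in E(S)$, so $\alpha_s$ is a homeomorphism from $D^\alpha_{s^*s}$ onto $D^\alpha_{ss^*}$. It is always assumed that $\bigcup_{e\in E(S)}D_e^\alpha=X$. The action $\alpha$ on a locally compact Boolean space $X$ is Boolean if (1) $D_e^\alpha$ is a compact open subset of $X$ for all $e\in E(S)$, and (2) the family of sets $D_e^\alpha\cap\bigcap_{f\in P}(X\setminus D_f^\alpha)$, with $e\in E(S)$ and $P\subset E(S)$ finite, forms a basis of $X$. A point $x\in X$ is a fixed point of $\alpha$ if $\alpha_s(x)=x$ for every $s\in S$ with $x\in D^\alpha_{s^*s}$ (equivalently, $\{x\}$ is an invariant subset of the unit space of the groupoid $S\ltimes_\alpha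 X$). *)

theory Defs
  imports "HOL-Analysis.Analysis"
begin

class inverse_semigroup = semigroup_mult +
  fixes star :: "'a \<Rightarrow> 'a"
  assumes mult_star_mult: "s = s * star s * s"
    and star_mult_star: "star s = star s * s * star s"
    and star_unique: "s = s * t * s \<Longrightarrow> t = t * s * t \<Longrightarrow> t = star s"

definition idempotents :: "'a::semigroup_mult set" where
  "idempotents = {e. e * e = e}"

inductive_set inverse_generated :: "'a::inverse_semigroup set \<Rightarrow> 'a set"
  for F :: "'a set" where
  incl: "s \<in> F \<Longrightarrow> s \<in> inverse_generated F"
| mult: "s \<in> inverse_generated F \<Longrightarrow> t \<in> inverse_generated F \<Longrightarrow> s * t \<in> inverse_generated F"
| star: "s \<in> inverse_generated F \<Longrightarrow> star s \<in> inverse_generated F"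

definition binary_homs :: "('a::semigroup_mult \<Rightarrow> nat) set" where
  "binary_homs = {h. range h \<subseteq> {0, 1} \<and> (\<forall>s t. h (s * t) = h s * h t)}"

definition is_basis :: "'b topology \<Rightarrow> 'b set set \<Rightarrow> bool" where
  "is_basis X \<B> \<longleftrightarrow> openin X = arbitrary union_of (\<lambda>U. U \<in> \<B>)"

definition locally_compact_Boolean_space :: "'b topology \<Rightarrow> bool" where
  "locally_compact_Boolean_space X \<longleftrightarrow>
     locally_compact_space X \<and> Hausdorff_space X \<and>
     (\<exists>\<B>. is_basis X \<B> \<and> (\<forall>U\<in>\<B>. compactin X U \<and> openin X U))"

text \<open>Elements of $I_X$ are represented as partial maps with open domain and open range;
  their product is composition of partial maps, \<open>f \<circ>\<^sub>m g\<close> (first \<open>g\<close>, then \<open>f\<close>).\<close>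

definition partial_homeos :: "'b topology \<Rightarrow> ('b \<rightharpoonup> 'b) set" where
  "partial_homeos X = {f. openin X (dom f) \<and> openin X (ran f) \<and>
     homeomorphic_map (subtopology X (dom f)) (subtopology X (ran f)) (the \<circ> f)}"

definition is_action :: "'b topology \<Rightarrow> ('a::inverse_semigroup \<Rightarrow> ('b \<rightharpoonup> 'b)) \<Rightarrow> bool" where
  "is_action X \<alpha> \<longleftrightarrow>
     (\<forall>s. \<alpha> s \<in> partial_homeos X) \<and>
     (\<forall>s t. \<alpha> (s * t) = \<alpha> s \<circ>\<^sub>m \<alpha> t) \<and>
     (\<Union>e\<in>idempotents. dom (\<alpha> e)) = topspace X"

definition is_Boolean_action :: "'b topology \<Rightarrow> ('a::inverse_semigroup \<Rightarrow> ('b \<rightharpoonup> 'b)) \<Rightarrow> bool" where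
  "is_Boolean_action X \<alpha> \<longleftrightarrow>
     is_action X \<alpha> \<and>
     (\<forall>e\<in>idempotents. compactin X (dom (\<alpha> e)) \<and> openin X (dom (\<alpha> e))) \<and>
     is_basis X {dom (\<alpha> e) \<inter> (\<Inter>f\<in>P. topspace X - dom (\<alpha> f)) | e P.
                   e \<in> idempotents \<and> P \<subseteq> idempotents \<and> finite P}"

definition fixed_points :: "'b topology \<Rightarrow> ('a::inverse_semigroup \<Rightarrow> ('b \<rightharpoonup> 'b)) \<Rightarrow> 'b set" where
  "fixed_points X \<alpha> =
     {x \<in> topspace X. \<forall>s. x \<in> dom (\<alpha> (star s * s)) \<longrightarrow> \<alpha> s x = Some x}"

end

theory Submission
  imports Defs
begin

text \<open>A fixed point \<open>x\<close> gives the homomorphism sending \<open>s\<close> to 1 iff \<open>\<alpha> s\<close> is defined at \<open>x\<close>: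
  every \<open>\<alpha> s\<close> that is defined at \<open>x\<close> fixes it, so \<open>\<alpha> (s * t)\<close> is defined at \<open>x\<close> iff both \<open>\<alpha> s\<close>
  and \<open>\<alpha> t\<close> are. These homomorphisms separate fixed points because the domains of idempotents
  and their complements generate a Hausdorff topology. There are finitely many homomorphisms,
  since each is determined by its values on a generating set.\<close>

lemma binary_homs_cases:
  assumes "h \<in> binary_homs"
  shows "h s = 0 \<or> h s = 1"
  using assms by (auto simp: binary_homs_def)

lemma binary_homs_mult:
  assumes "h \<in> binary_homs"
  shows "h (s * t) = h s * h t"
  using assms by (simp add: binary_homs_def)

text \<open>Under \<open>h\<close>, the two identities defining \<open>star\<close> make each of
  \<open>h s\<close> and \<open>h (star s)\<close> a factor of the other, so they vanish
  together.\<close>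

lemma binary_homs_star:
  fixes h :: "'a::inverse_semigroup \<Rightarrow> nat"
  assumes h: "h \<in> binary_homs"
  shows "h (star s) = h s"
proof -
  have "h s * h (star s) * h s = h s"
    by (simp only: binary_homs_mult[OF h, symmetric] mult_star_mult[symmetric])
  moreover have "h (star s) * h s * h (star s) = h (star s)"
    by (simp only: binary_homs_mult[OF h, symmetric] star_mult_star[symmetric])
  ultimately show ?thesis
    using binary_homs_cases[OF h, of s] binary_homs_cases[OF h, of "star s"] by auto
qed

lemma binary_homs_eqI:
  fixes g h :: "'a::inverse_semigroup \<Rightarrow> nat"
  assumes "g \<in> binary_homs" "h \<in> binary_homs"
    and "inverse_generated F = UNIV" "\<And>s. s \<in> F \<Longrightarrow> g s = h s"
  shows "g = h"
proof
  fix s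
  have "s \<in> inverse_generated F" using assms(3) by simp
  then show "g s = h s"
    by induction (simp_all add: assms(4) binary_homs_mult[OF assms(1)] binary_homs_mult[OF assms(2)]
        binary_homs_star[OF assms(1)] binary_homs_star[OF assms(2)])
qed

text \<open>A 0/1-valued homomorphism is recorded by the subset of \<open>F\<close> on which it is
  1, which embeds the homomorphisms into \<open>Pow F\<close>.\<close>

lemma finite_binary_homs:
  fixes F :: "'a::inverse_semigroup set"
  assumes "finite F" "inverse_generated F = UNIV"
  shows "finite (binary_homs :: ('a \<Rightarrow> nat) set)"
proof (rule inj_on_finite)
  show "inj_on (\<lambda>h. {s \<in> F. h s = 1}) (binary_homs :: ('a \<Rightarrow> nat) set)"
  proof (rule inj_onI)
    fix g h :: "'a \<Rightarrow> nat"
    assume g: "g \<in> binary_homs" and h: "h \<in> binary_homs"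
      and eq: "{s \<in> F. g s = 1} = {s \<in> F. h s = 1}"
    show "g = h"
    proof (rule binary_homs_eqI[OF g h assms(2)])
      fix s assume "s \<in> F"
      then have "g s = 1 \<longleftrightarrow> h s = 1" using eq by blast
      then show "g s = h s"
        using binary_homs_cases[OF g, of s] binary_homs_cases[OF h, of s] by auto
    qed
  qed
  show "(\<lambda>h. {s \<in> F. h s = 1}) ` (binary_homs :: ('a \<Rightarrow> nat) set) \<subseteq> Pow F" by auto
  show "finite (Pow F)" using assms(1) by simp
qed

lemma is_action_mult:
  assumes "is_action X \<alpha>"
  shows "\<alpha> (s * t) = \<alpha> s \<circ>\<^sub>m \<alpha> t"
  using assms by (simp add: is_action_def)

text \<open>Each of \<open>\<alpha> (star s * s)\<close> and \<open>\<alpha> s\<close> factors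
  through the other, by \<open>s = s * (star s * s)\<close> for the second. This lets the fixed
  point condition be tested on \<open>dom (\<alpha> s)\<close>.\<close>

lemma is_action_dom_star_mult:
  assumes "is_action X \<alpha>"
  shows "dom (\<alpha> (star s * s)) = dom (\<alpha> s)"
proof
  show "dom (\<alpha> (star s * s)) \<subseteq> dom (\<alpha> s)"
    by (auto simp: is_action_mult[OF assms] map_comp_def split: option.splits)
  have "\<alpha> s \<circ>\<^sub>m \<alpha> (star s * s) = \<alpha> s"
    by (simp only: is_action_mult[OF assms, symmetric] mult.assoc[symmetric] mult_star_mult[symmetric])
  then have "dom (\<alpha> s) = dom (\<alpha> s \<circ>\<^sub>m \<alpha> (star s * s))" by (rule arg_cong[symmetric])
  also have "\<dots> \<subseteq> dom (\<alpha> (star s * s))"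
    by (auto simp: map_comp_def split: option.splits)
  finally show "dom (\<alpha> s) \<subseteq> dom (\<alpha> (star s * s))" .
qed

definition dom_indicator :: "('a \<Rightarrow> ('b \<rightharpoonup> 'b)) \<Rightarrow> 'b \<Rightarrow> 'a \<Rightarrow> nat" where
  "dom_indicator \<alpha> x s = (if x \<in> dom (\<alpha> s) then 1 else 0)"

lemma fixed_pointsD:
  assumes "is_action X \<alpha>" "x \<in> fixed_points X \<alpha>" "x \<in> dom (\<alpha> s)"
  shows "\<alpha> s x = Some x"
  using assms(2,3) is_action_dom_star_mult[OF assms(1), of s] by (simp add: fixed_points_def)

lemma dom_indicator_binary_hom:
  assumes act: "is_action X \<alpha>" and x: "x \<in> fixed_points X \<alpha>"
  shows "dom_indicator \<alpha> x \<in> binary_homs"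
proof -
  have "x \<in> dom (\<alpha> (s * t)) \<longleftrightarrow> x \<in> dom (\<alpha> s) \<and> x \<in> dom (\<alpha> t)" for s t
  \<comment> \<open>The composite applies \<open>\<alpha> t\<close> first. If that is defined at
    \<open>x\<close>, its value is \<open>x\<close> again, so only definedness of
    \<open>\<alpha> s\<close> at \<open>x\<close> remains; otherwise both sides fail.\<close>
  proof (cases "x \<in> dom (\<alpha> t)")
    case True
    then have "\<alpha> t x = Some x" using fixed_pointsD[OF act x] by simp
    then show ?thesis
      by (simp add: is_action_mult[OF act] dom_def map_comp_def)
  next
    case False
    then show ?thesis
      by (auto simp: is_action_mult[OF act] map_comp_def split: option.splits)
  qed
  then show ?thesis
    by (auto simp: binary_homs_def dom_indicator_def)
qed

text \<open>This is where the covering condition on actions enters: some idempotent has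
  \<open>x\<close> in its domain.\<close>

lemma dom_indicator_nonzero:
  assumes "is_action X \<alpha>" "x \<in> topspace X"
  shows "dom_indicator \<alpha> x \<noteq> (\<lambda>_. 0)"
proof -
  have "x \<in> (\<Union>e\<in>idempotents. dom (\<alpha> e))" using assms by (simp add: is_action_def)
  then obtain e where "x \<in> dom (\<alpha> e)" by blast
  then have "dom_indicator \<alpha> x e = 1" by (simp add: dom_indicator_def)
  then show ?thesis by auto
qed

text \<open>Membership of a point in a basic set depends only on which idempotent domains contain
  it. Points with equal indicators thus lie in the same open sets, which the Hausdorff property
  forbids for distinct points.\<close>

lemma inj_on_dom_indicator:
  assumes "Hausdorff_space X" "is_Boolean_action X \<alpha>"
  shows "inj_on (dom_indicator \<alpha>) (topspace X)"
proof (rule inj_onI, rule ccontr)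
  fix x y
  assume x: "x \<in> topspace X" and y: "y \<in> topspace X"
    and eq: "dom_indicator \<alpha> x = dom_indicator \<alpha> y" and "x \<noteq> y"
  have same: "x \<in> dom (\<alpha> s) \<longleftrightarrow> y \<in> dom (\<alpha> s)" for s
    using fun_cong[OF eq, of s] by (simp add: dom_indicator_def split: if_splits)
  obtain U where U: "openin X U" "x \<in> U" "y \<notin> U"
    using assms(1) x y \<open>x \<noteq> y\<close> unfolding Hausdorff_space_def disjnt_def by blast
  let ?B = "{dom (\<alpha> e) \<inter> (\<Inter>f\<in>P. topspace X - dom (\<alpha> f)) | e P.
              e \<in> idempotents \<and> P \<subseteq> idempotents \<and> finite P}"
  have "(arbitrary union_of (\<lambda>V. V \<in> ?B)) U"
    using assms(2) U(1) by (simp only: is_Boolean_action_def is_basis_def)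
  then obtain \<U> where UU: "\<U> \<subseteq> ?B" "\<Union>\<U> = U"
    unfolding union_of_def arbitrary_def by (auto simp only: subset_iff mem_Collect_eq)
  from U(2) UU(2) obtain V where V: "V \<in> \<U>" "x \<in> V" by (auto simp only: Union_iff)
  have "V \<subseteq> U" using UU(2) V(1) by (auto simp only: Union_iff)
  have "V \<in> ?B" using UU(1) V(1) by (rule subsetD)
  then obtain e P where V_eq: "V = dom (\<alpha> e) \<inter> (\<Inter>f\<in>P. topspace X - dom (\<alpha> f))"
    by blast
  \<comment> \<open>\<open>same\<close> carries over both membership in the domain of
    \<open>\<alpha> e\<close> and non-membership in the removed domains.\<close>
  have "y \<in> V" using V(2) same y unfolding V_eq by (simp only: Int_iff INT_iff Diff_iff) simp
  then show False using \<open>V \<subseteq> U\<close> U(3) by blast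
qed

theorem corollary5p3p2:
  fixes X :: "'b topology"
    and \<alpha> :: "'a::inverse_semigroup \<Rightarrow> ('b \<rightharpoonup> 'b)"
  assumes "\<exists>F :: 'a set. finite F \<and> inverse_generated F = UNIV"
    and "locally_compact_Boolean_space X"
    and "is_Boolean_action X \<alpha>"
  shows "finite (fixed_points X \<alpha>) \<and>
         finite {h \<in> (binary_homs :: ('a \<Rightarrow> nat) set). h \<noteq> (\<lambda>_. 0)} \<and>
         card (fixed_points X \<alpha>) \<le> card {h \<in> (binary_homs :: ('a \<Rightarrow> nat) set). h \<noteq> (\<lambda>_. 0)}"
proof -
  let ?H = "{h \<in> (binary_homs :: ('a \<Rightarrow> nat) set). h \<noteq> (\<lambda>_. 0)}"
  have act: "is_action X \<alpha>" using assms(3) by (simp add: is_Boolean_action_def)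
  have sub: "fixed_points X \<alpha> \<subseteq> topspace X" by (auto simp: fixed_points_def)
  have fin: "finite ?H" using assms(1) finite_binary_homs by (metis finite_Collect_conjI Collect_mem_eq)
  have "Hausdorff_space X" using assms(2) by (simp add: locally_compact_Boolean_space_def)
  then have inj: "inj_on (dom_indicator \<alpha>) (fixed_points X \<alpha>)"
    using inj_on_dom_indicator assms(3) sub inj_on_subset by blast
  have img: "dom_indicator \<alpha> ` fixed_points X \<alpha> \<subseteq> ?H"
  proof (intro image_subsetI CollectI conjI)
    fix x assume x: "x \<in> fixed_points X \<alpha>"
    show "dom_indicator \<alpha> x \<in> binary_homs" by (rule dom_indicator_binary_hom[OF act x])
    show "dom_indicator \<alpha> x \<noteq> (\<lambda>_. 0)" by (rule dom_indicator_nonzero[OF act subsetD[OF sub x]])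
  qed
  \<comment> \<open>Finiteness has its own conjuncts because \<open>card\<close> of an infinite set
    is 0; the one injection into \<open>?H\<close> yields both finiteness of the fixed points and
    the bound.\<close>
  show ?thesis
    by (intro conjI inj_on_finite[OF inj img fin] fin card_inj_on_le[OF inj img fin])
qed

end
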